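(* Let $\alpha,\beta,\gamma,b,c,z\in\mathbb{C}$ and $p\ge 0$ with $\mathrm{Re}(\alpha)>0$ and $\mathrm{Re}(c)>\mathrm{Re}(b)>0$. Then for every integer $n\ge 0$, $$\frac{d^n}{dz^n}\left[{}^{ML}\Phi_{p}(b;c;z)\right]=\frac{(b)_n}{(c)_n}\;{}^{ML}\Phi_{p}(b+n;c+n;z).$$
   Context: The three-parameter Mittag-Leffler function is $E_{\alpha,\beta}^{\gamma}(z)=\sum_{n=0}^{\infty}\frac{(\gamma)_n}{\Gamma(\alpha n+\beta)}\frac{z^n}{n!}$ for $\alpha,\beta,\gamma\in\mathbb{C}$, $\mathrm{Re}(\alpha)>0$, where $(\gamma)_n=\gamma(\gamma+1)\cdots(\gamma+n-1)$, $(\gamma)_0=1$. The ML-generalized beta function is ${}^{ML}B_{p}(x,y)=\int_{0}^{1}t^{x-1}(1-t)^{y-1}E_{\alpha,\beta}^{\gamma}\left(-\frac{p}{t(1-t)}\right)dt$ for $\mathrm{Re}(x)>0$, $\mathrm{Re}(y)>0$ (the parameters $\alpha,\beta,\gamma$ are suppressed in the notation), and $B(x,y)=\int_0^1 t^{x-1}(1-t)^{y-1}dt$ is the classical beta function. The ML-generalized confluent hypergeometric function is ${}^{ML}\Phi_{p}(b;c;z)=\sum_{n=0}^{\infty}\frac{{}^{ML}B_{p}(b+n,c-b)}{B(b,c-b)}\frac{z^n}{n!}$ for $p\ge 0$, $\mathrm{Re}(c)>\mathrm{Re}(b)>0$, $\mathrm{Re}(\alpha)>0$. *)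

theory Defs
  imports "HOL-Analysis.Analysis"
begin

text \<open>
  The reciprocal Gamma function is entire, so \<open>rGamma (\<alpha> n + \<beta>)\<close> gives \<open>1 / \<Gamma>(\<alpha> n + \<beta>)\<close> its
  usual value 0 at the poles of \<open>\<Gamma>\<close>.
\<close>

definition mittag_leffler3 :: "complex \<Rightarrow> complex \<Rightarrow> complex \<Rightarrow> complex \<Rightarrow> complex" where
  "mittag_leffler3 \<alpha> \<beta> \<gamma> z =
     (\<Sum>n. pochhammer \<gamma> n * rGamma (\<alpha> * of_nat n + \<beta>) * (z ^ n / fact n))"

text \<open>
  The Euler integral; the library's \<open>Beta\<close> is a quotient of Gamma values, and its integral
  representation is available there for real arguments only. Both integrals below are
  Henstock-Kurzweil integrals, which agree with the Lebesgue integral for absolutely integrable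
  functions and also cover conditionally convergent improper integrals. The integrands'
  values at the end points are immaterial.
\<close>

definition beta_integral :: "complex \<Rightarrow> complex \<Rightarrow> complex" where
  "beta_integral x y =
     integral {0..1} (\<lambda>t::real. of_real t powr (x - 1) * of_real (1 - t) powr (y - 1))"

definition beta_ML ::
    "complex \<Rightarrow> complex \<Rightarrow> complex \<Rightarrow> real \<Rightarrow> complex \<Rightarrow> complex \<Rightarrow> complex" where
  "beta_ML \<alpha> \<beta> \<gamma> p x y =
     integral {0..1} (\<lambda>t::real. of_real t powr (x - 1) * of_real (1 - t) powr (y - 1) *
       mittag_leffler3 \<alpha> \<beta> \<gamma> (of_real (- (p / (t * (1 - t))))))"

definition Phi_ML ::
    "complex \<Rightarrow> complex \<Rightarrow> complex \<Rightarrow> real \<Rightarrow> complex \<Rightarrow> complex \<Rightarrow> complex \<Rightarrow> complex" where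
  "Phi_ML \<alpha> \<beta> \<gamma> p b c z =
     (\<Sum>n. beta_ML \<alpha> \<beta> \<gamma> p (b + of_nat n) (c - b) / beta_integral b (c - b) * (z ^ n / fact n))"

end

theory Submission
  imports Defs
begin

text \<open>
  Differentiating the power series term by term shifts the numerators
  \<open>beta_ML (b + k) (c - b)\<close>, and the recurrence
  \<open>B (b + 1, c - b) = b / c * B (b, c - b)\<close> turns the shifted series into the one for
  \<open>b + 1, c + 1\<close>. Convergence needs no growth estimate for the Mittag-Leffler function: if the
  integrand is Henstock-Kurzweil integrable for some \<open>k\<close>, the later ones arise from it by
  multiplication with the monotone functions \<open>t ^ m\<close>, so by the second mean value theorem the
  numerators are bounded. Numerators whose integral does not exist are 0.
\<close>

text \<open>The second mean value theorem expresses the integral of \<open>g t * f t\<close> through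
  \<open>g a\<close>, \<open>g b\<close> and two partial integrals of \<open>f\<close>. These are
  continuous in their variable end point, hence bounded on the compact interval, so \<open>C\<close>
  depends on \<open>f\<close> only.\<close>

lemma integral_mult_mono_bounded_real:
  fixes f :: "real \<Rightarrow> real"
  assumes f: "f integrable_on {a..b}" and ab: "a \<le> b"
  obtains C where "C \<ge> 0"
    "\<And>g. \<lbrakk>mono_on {a..b} g; \<bar>g a\<bar> \<le> 1; \<bar>g b\<bar> \<le> 1\<rbrakk> \<Longrightarrow> \<bar>integral {a..b} (\<lambda>t. g t * f t)\<bar> \<le> C"
proof -
  have "bounded ((\<lambda>x. integral {a..x} f) ` {a..b})" "bounded ((\<lambda>x. integral {x..b} f) ` {a..b})"
    using f by (auto intro!: compact_imp_bounded compact_continuous_image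
        indefinite_integral_continuous_1 indefinite_integral_continuous_1')
  then obtain M N where M: "\<And>x. x \<in> {a..b} \<Longrightarrow> \<bar>integral {a..x} f\<bar> \<le> M"
    and N: "\<And>x. x \<in> {a..b} \<Longrightarrow> \<bar>integral {x..b} f\<bar> \<le> N"
    unfolding bounded_iff ball_simps real_norm_def by metis
  show thesis
  proof (rule that)
    show "M + N \<ge> 0"
      using M[of a] N[of a] ab by force
    fix g :: "real \<Rightarrow> real"
    assume g: "mono_on {a..b} g" "\<bar>g a\<bar> \<le> 1" "\<bar>g b\<bar> \<le> 1"
    obtain x where x: "x \<in> {a..b}"
      "integral {a..b} (\<lambda>t. g t * f t) = g a * integral {a..x} f + g b * integral {x..b} f"
      using second_mean_value_theorem[of f a b g] f ab g(1) by (auto simp: mono_on_def)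
    have "\<bar>g a * integral {a..x} f\<bar> \<le> 1 * M" "\<bar>g b * integral {x..b} f\<bar> \<le> 1 * N"
      unfolding abs_mult using g M[OF x(1)] N[OF x(1)] by (intro mult_mono; simp)+
    then show "\<bar>integral {a..b} (\<lambda>t. g t * f t)\<bar> \<le> M + N"
      unfolding x(2) by linarith
  qed
qed

lemma integral_mult_mono_bounded:
  fixes f :: "real \<Rightarrow> complex"
  assumes f: "f integrable_on {a..b}" and ab: "a \<le> b"
  obtains C where "C \<ge> 0"
    "\<And>g. \<lbrakk>mono_on {a..b} g; \<bar>g a\<bar> \<le> 1; \<bar>g b\<bar> \<le> 1\<rbrakk> \<Longrightarrow> norm (integral {a..b} (\<lambda>t. g t *\<^sub>R f t)) \<le> C"
proof -
  have Re_Im: "(\<lambda>t. Re (f t)) integrable_on {a..b}" "(\<lambda>t. Im (f t)) integrable_on {a..b}"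
    using integrable_linear[OF f bounded_linear_Re] integrable_linear[OF f bounded_linear_Im]
    by (simp_all add: o_def)
  obtain C where "C \<ge> 0" and C: "\<And>g. \<lbrakk>mono_on {a..b} g; \<bar>g a\<bar> \<le> 1; \<bar>g b\<bar> \<le> 1\<rbrakk> \<Longrightarrow>
      \<bar>integral {a..b} (\<lambda>t. g t * Re (f t))\<bar> \<le> C"
    using integral_mult_mono_bounded_real[OF Re_Im(1) ab] by blast
  obtain D where "D \<ge> 0" and D: "\<And>g. \<lbrakk>mono_on {a..b} g; \<bar>g a\<bar> \<le> 1; \<bar>g b\<bar> \<le> 1\<rbrakk> \<Longrightarrow>
      \<bar>integral {a..b} (\<lambda>t. g t * Im (f t))\<bar> \<le> D"
    using integral_mult_mono_bounded_real[OF Re_Im(2) ab] by blast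
  show thesis
  proof (rule that)
    show "C + D \<ge> 0"
      using \<open>C \<ge> 0\<close> \<open>D \<ge> 0\<close> by simp
    fix g :: "real \<Rightarrow> real"
    assume g: "mono_on {a..b} g" "\<bar>g a\<bar> \<le> 1" "\<bar>g b\<bar> \<le> 1"
    let ?h = "\<lambda>t. g t *\<^sub>R f t"
    show "norm (integral {a..b} ?h) \<le> C + D"
    proof (cases "?h integrable_on {a..b}")
      case True
      have "Re (integral {a..b} ?h) = integral {a..b} (\<lambda>t. g t * Re (f t))"
           "Im (integral {a..b} ?h) = integral {a..b} (\<lambda>t. g t * Im (f t))"
        using integral_linear[OF True bounded_linear_Re] integral_linear[OF True bounded_linear_Im]
        by (simp_all add: o_def)
      then show ?thesis
        using cmod_le[of "integral {a..b} ?h"] C[OF g] D[OF g] by linarith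
    next
      \<comment> \<open>A nonexistent integral is 0 by convention, which is within the
        bound.\<close>
      case False
      then show ?thesis
        using \<open>C \<ge> 0\<close> \<open>D \<ge> 0\<close> by (simp add: not_integrable_integral)
    qed
  qed
qed

text \<open>At \<open>t = 0\<close> both sides vanish, even for \<open>m = 0\<close>, because
  \<open>0 powr x = 0\<close> for every exponent.\<close>

lemma powr_add_of_nat_of_real:
  fixes x :: complex and t :: real
  shows "of_real t powr (x + of_nat m) = t ^ m *\<^sub>R of_real t powr x"
  by (cases "t = 0") (simp_all add: powr_add powr_nat scaleR_conv_of_real)

lemma beta_ML_bounded: "\<exists>C. \<forall>k. norm (beta_ML \<alpha> \<beta> \<gamma> p (x + of_nat k) y) \<le> C"
proof -
  define f where "f k t = of_real t powr (x + of_nat k - 1) * of_real (1 - t) powr (y - 1) *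
    mittag_leffler3 \<alpha> \<beta> \<gamma> (of_real (- (p / (t * (1 - t)))))" for k t
  have beta_eq: "beta_ML \<alpha> \<beta> \<gamma> p (x + of_nat k) y = integral {0..1} (f k)" for k
    unfolding beta_ML_def f_def ..
  have f_add: "f (k + m) t = t ^ m *\<^sub>R f k t" for k m t
    using powr_add_of_nat_of_real[of t "x + of_nat k - 1" m] by (simp add: f_def algebra_simps)
  show ?thesis
  proof (cases "\<exists>k. f k integrable_on {0..1}")
    case True
    \<comment> \<open>With the least such index, every earlier integral is 0 and every later
      integrand is \<open>f k0\<close> times a power of \<open>t\<close>, so one \<open>C\<close>
      serves all \<open>k\<close>.\<close>
    define k0 where "k0 = (LEAST k. f k integrable_on {0..1})"
    have k0: "f k0 integrable_on {0..1}"
      unfolding k0_def using True by (rule LeastI_ex)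
    obtain C where C: "C \<ge> 0" "\<And>g. \<lbrakk>mono_on {0..1} g; \<bar>g 0\<bar> \<le> 1; \<bar>g 1\<bar> \<le> 1\<rbrakk> \<Longrightarrow>
        norm (integral {0..1} (\<lambda>t. g t *\<^sub>R f k0 t)) \<le> C"
      using integral_mult_mono_bounded[OF k0] by auto
    have "norm (integral {0..1} (f k)) \<le> C" for k
    proof (cases "k0 \<le> k")
      case True
      have "f k = (\<lambda>t. t ^ (k - k0) *\<^sub>R f k0 t)"
        using f_add[of k0 "k - k0"] True by auto
      then show ?thesis
        using C(2)[of "\<lambda>t. t ^ (k - k0)"] by (simp add: mono_on_def power_mono power_0_left)
    next
      case False
      then have "\<not> f k integrable_on {0..1}"
        unfolding k0_def by (intro not_less_Least) simp
      then show ?thesis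
        using C(1) by (simp add: not_integrable_integral)
    qed
    then show ?thesis
      unfolding beta_eq by blast
  next
    case False
    then show ?thesis
      unfolding beta_eq by (auto simp: not_integrable_integral)
  qed
qed

text \<open>
  The identity integrates the derivative of \<open>t powr x * (1 - t) powr y\<close>. It is exact
  even if the integrals do not exist, since then both sides are 0.
\<close>
lemma beta_integral_plus1_left:
  assumes x: "Re x > 0" and y: "Re y > 0"
  shows "beta_integral (x + 1) y = x / (x + y) * beta_integral x y"
proof -
  define w :: "real \<Rightarrow> complex" where "w t = of_real t powr (x - 1) * of_real (1 - t) powr (y - 1)" for t
  define v :: "real \<Rightarrow> complex" where "v t = of_real t powr x * of_real (1 - t) powr (y - 1)" for t
  have nz: "x \<noteq> 0" "x + y \<noteq> 0"
    using x y by (auto simp: complex_eq_iff)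
  \<comment> \<open>The product rule gives x t^(x-1) (1-t)^y - y t^x (1-t)^(y-1). Splitting off one
    factor 1-t from (1-t)^y turns the first term into \<open>x * w t - x * v t\<close>. Only the
    interior is differentiated, since \<open>w\<close> and \<open>v\<close> may be singular at the
    end points.\<close>
  have "((\<lambda>t. x * w t - (x + y) * v t) has_integral
      (of_real 1 powr x * of_real (1 - 1) powr y - of_real 0 powr x * of_real (1 - 0) powr y)) {0..1}"
  proof (rule fundamental_theorem_of_calculus_interior)
    show "continuous_on {0..1} (\<lambda>t. of_real t powr x * of_real (1 - t) powr y :: complex)"
      using x y by (auto intro!: continuous_intros)
    fix t :: real
    assume t: "t \<in> {0<..<1}"
    let ?z = "of_real t :: complex"
    have "((\<lambda>z. z powr x * (1 - z) powr y) has_field_derivative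
        x * ?z powr (x - 1) * (1 - ?z) powr y - ?z powr x * (y * (1 - ?z) powr (y - 1))) (at ?z)"
    proof -
      have "?z \<notin> \<real>\<^sub>\<le>\<^sub>0" "1 - ?z \<notin> \<real>\<^sub>\<le>\<^sub>0"
        using t by (auto simp: complex_nonpos_Reals_iff)
      then show ?thesis
        by (auto intro!: derivative_eq_intros simp: algebra_simps)
    qed
    moreover have "?z powr x = ?z * ?z powr (x - 1)" "(1 - ?z) powr y = (1 - ?z) * (1 - ?z) powr (y - 1)"
      using t by (auto simp: powr_diff)
    ultimately have "((\<lambda>z. z powr x * (1 - z) powr y) has_field_derivative
        x * w t - (x + y) * v t) (at ?z)"
      by (simp add: w_def v_def algebra_simps)
    then show "((\<lambda>t. of_real t powr x * of_real (1 - t) powr y) has_vector_derivative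
        x * w t - (x + y) * v t) (at t)"
      using has_vector_derivative_real_field by fastforce
  qed simp
  then have diff: "((\<lambda>t. x * w t - (x + y) * v t) has_integral 0) {0..1}"
    using x y by (auto simp: powr_def split: if_splits)
  have beta: "beta_integral x y = integral {0..1} w" "beta_integral (x + 1) y = integral {0..1} v"
    unfolding beta_integral_def w_def v_def by simp_all
  show ?thesis
  proof (cases "w integrable_on {0..1}")
    case True
    then have "((\<lambda>t. (x * w t - (x * w t - (x + y) * v t)) / (x + y)) has_integral
        (x * integral {0..1} w - 0) / (x + y)) {0..1}"
      by (intro has_integral_divide has_integral_diff has_integral_mult_right diff)
        (simp add: integrable_integral)
    then show ?thesis
      using nz by (simp add: beta integral_unique)
  next
    case False
    \<comment> \<open>By \<open>diff\<close> and the nonzero coefficients, \<open>w\<close> and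
      \<open>v\<close> are integrable or not together.\<close>
    have "\<not> v integrable_on {0..1}"
    proof
      assume "v integrable_on {0..1}"
      then have "((\<lambda>t. ((x * w t - (x + y) * v t) + (x + y) * v t) / x) has_integral
          (0 + (x + y) * integral {0..1} v) / x) {0..1}"
        by (intro has_integral_divide has_integral_add has_integral_mult_right diff)
          (simp add: integrable_integral)
      then have "w integrable_on {0..1}"
        using nz by (simp add: has_integral_integrable)
      with False show False ..
    qed
    with False show ?thesis
      by (simp add: beta not_integrable_integral)
  qed
qed

text \<open>This is the case of one derivative. The shift by 1 preserves the hypotheses on
  \<open>b\<close> and \<open>c\<close>, so it can be iterated.\<close>

lemma Phi_ML_has_field_derivative:
  assumes "Re c > Re b" and "Re b > 0"
  shows "(Phi_ML \<alpha> \<beta> \<gamma> p b c has_field_derivative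
           b / c * Phi_ML \<alpha> \<beta> \<gamma> p (b + 1) (c + 1) z) (at z)"
proof -
  define a where "a k = beta_ML \<alpha> \<beta> \<gamma> p (b + of_nat k) (c - b)" for k
  define B where "B = beta_integral b (c - b)"
  define u where "u k = a k / B / fact k" for k
  have nz: "b \<noteq> 0" "c \<noteq> 0"
    using assms by auto
  have B_Suc: "beta_integral (b + 1) (c - b) = b / c * B"
    using beta_integral_plus1_left[of b "c - b"] assms by (simp add: B_def)
  obtain C where C: "\<And>k. norm (a k) \<le> C"
    unfolding a_def using beta_ML_bounded by metis
  \<comment> \<open>The bounded numerators leave the exponential series as majorant. If
    \<open>B = 0\<close>, division by zero makes all terms and the majorant 0.\<close>
  have summable_u: "summable (\<lambda>k. u k * y ^ k)" for y
  proof (rule summable_comparison_test')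
    show "summable (\<lambda>k. C / norm B * (inverse (fact k) * norm y ^ k))"
      by (intro summable_mult summable_exp)
    show "norm (u k * y ^ k) \<le> C / norm B * (inverse (fact k) * norm y ^ k)" if "k \<ge> 0" for k
      using mult_right_mono[OF C[of k], of "norm y ^ k / (norm B * fact k)"]
      by (simp add: u_def norm_mult norm_divide norm_power field_simps)
  qed
  have Phi: "Phi_ML \<alpha> \<beta> \<gamma> p b c = (\<lambda>z. \<Sum>k. u k * z ^ k)"
    by (simp add: Phi_ML_def u_def a_def B_def fun_eq_iff)
  have diffs_u: "diffs u k = a (Suc k) / B / fact k" for k
    unfolding diffs_def u_def fact_Suc
    by (simp add: divide_simps del: of_nat_Suc)
  \<comment> \<open>The shift leaves \<open>c - b\<close> unchanged, so the numerators become
    \<open>a (Suc k)\<close>, and the new denominator \<open>b / c * B\<close> contributes the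
    factor \<open>c / b\<close>.\<close>
  have Phi_Suc: "Phi_ML \<alpha> \<beta> \<gamma> p (b + 1) (c + 1) z = (\<Sum>k. c / b * (diffs u k * z ^ k))"
    using nz B_Suc by (simp add: Phi_ML_def diffs_u a_def add_ac mult_ac)
  have "summable (\<lambda>k. diffs u k * z ^ k)"
    using summable_u by (rule termdiff_converges_all)
  then have "b / c * Phi_ML \<alpha> \<beta> \<gamma> p (b + 1) (c + 1) z = (\<Sum>k. diffs u k * z ^ k)"
    unfolding Phi_Suc by (subst suminf_mult) (use nz in simp_all)
  then show ?thesis
    unfolding Phi using termdiffs_strong_converges_everywhere[OF summable_u] by simp
qed

theorem theorem3p4:
  fixes \<alpha> \<beta> \<gamma> b c z :: complex and p :: real and n :: nat
  assumes "p \<ge> 0" and "Re \<alpha> > 0" and "Re c > Re b" and "Re b > 0"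
  shows "Phi_ML \<alpha> \<beta> \<gamma> p b c holomorphic_on UNIV \<and>
         (deriv ^^ n) (Phi_ML \<alpha> \<beta> \<gamma> p b c) z =
           pochhammer b n / pochhammer c n * Phi_ML \<alpha> \<beta> \<gamma> p (b + of_nat n) (c + of_nat n) z"
proof
  show "Phi_ML \<alpha> \<beta> \<gamma> p b c holomorphic_on UNIV"
    unfolding holomorphic_on_open[OF open_UNIV]
    using Phi_ML_has_field_derivative[OF assms(3,4)] by blast
  \<comment> \<open>The induction needs an equality of functions, because the next
    \<open>deriv\<close> acts on the whole function and not on its value at
    \<open>z\<close>.\<close>
  have "(deriv ^^ n) (Phi_ML \<alpha> \<beta> \<gamma> p b c) =
      (\<lambda>z. pochhammer b n / pochhammer c n * Phi_ML \<alpha> \<beta> \<gamma> p (b + of_nat n) (c + of_nat n) z)"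
  proof (induction n)
    case (Suc n)
    have "deriv (\<lambda>z. pochhammer b n / pochhammer c n *
            Phi_ML \<alpha> \<beta> \<gamma> p (b + of_nat n) (c + of_nat n) z) w =
        pochhammer b n / pochhammer c n * ((b + of_nat n) / (c + of_nat n) *
            Phi_ML \<alpha> \<beta> \<gamma> p (b + of_nat n + 1) (c + of_nat n + 1) w)" for w
      using assms by (intro DERIV_imp_deriv DERIV_cmult Phi_ML_has_field_derivative) auto
    then show ?case
      by (simp add: Suc.IH pochhammer_Suc fun_eq_iff add_ac)
  qed simp
  then show "(deriv ^^ n) (Phi_ML \<alpha> \<beta> \<gamma> p b c) z =
      pochhammer b n / pochhammer c n * Phi_ML \<alpha> \<beta> \<gamma> p (b + of_nat n) (c + of_nat n) z"
    by simp
qed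

end
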